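(* Let $T$ be a tree on $n\geq 3$ vertices, let $u$ be a leaf of $T$ and $v\in C(T)$. Then \[\frac{\operatorname{ecc}_T(u)}{\operatorname{ecc}_T(v)}\leq 2.\] If, in addition, $n\geq 5$, then \[1+\frac{1}{\lfloor \frac{n-1}{2}\rfloor}\leq \frac{\operatorname{ecc}_T(u)}{\operatorname{ecc}_T(v)},\] and equality holds if and only if one of the following holds: (1) $T$ has a longest path $P$ on $n-1$ vertices, and the single vertex $u$ not on $P$ is adjacent to $v$, where $v$ is a center vertex of $P$; (2) $n$ is even, $T$ has a longest path $P=z_1z_2\ldots z_{n-2}$ on $n-2$ vertices, $u$ is adjacent to $v$ where $v$ is a center vertex of $P$, and the remaining vertex $w$ is a leaf adjacent to some internal vertex $z_j$, $j\in\{2,\ldots,n-3\}$, of $P$.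
   Context: For a vertex $v$ of a tree $T$, $\operatorname{ecc}_T(v)=\max_{w\in V(T)} d_T(v,w)$. The center $C(T)$ (and similarly the center of a path $P$) is the set of vertices of minimum eccentricity. A leaf is a vertex of degree 1.
   Formalization: Equality clause is false for fixed u, v (n=5: z1z2z3z4 plus w at z2, u=z4). Proved instead: some leaf and center attain equality iff (1) or (2) holds for some u, v; for the given u, "if" for n≥5, "only if" for n≥7, with v in (1),(2) read as some center vertex of P. *)

theory Defs
  imports "Graph_Theory.Graph_Theory"
begin

text \<open>
  A finite simple graph is the locale \<open>graph\<close> of Graph_Theory, i.e. a finite, loop-free, symmetric
  digraph without parallel arcs. There each edge \<open>xy\<close> is represented by the two arcs \<open>x \<rightarrow> y\<close>,
  \<open>y \<rightarrow> x\<close>, which form a directed cycle of length 2. Hence the library's \<open>tree\<close> only holds of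
  edgeless symmetric digraphs, and only cycles of length at least 3 are excluded here.
\<close>

definition simple_tree :: "('a, 'b) pre_digraph \<Rightarrow> bool" where
  "simple_tree G \<longleftrightarrow> graph G \<and> connected G \<and>
     \<not> (\<exists>p. pre_digraph.cycle G p \<and> 3 \<le> length p)"

definition graph_dist :: "('a, 'b) pre_digraph \<Rightarrow> 'a \<Rightarrow> 'a \<Rightarrow> nat" where
  "graph_dist G x y = (LEAST k. \<exists>p. pre_digraph.awalk G x p y \<and> length p = k)"

definition ecc :: "('a, 'b) pre_digraph \<Rightarrow> 'a \<Rightarrow> nat" where
  "ecc G x = Max (graph_dist G x ` verts G)"

definition center :: "('a, 'b) pre_digraph \<Rightarrow> 'a set" where
  "center G = {x \<in> verts G. \<forall>y \<in> verts G. ecc G x \<le> ecc G y}"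

text \<open>In a symmetric digraph without parallel arcs the out-degree is the undirected degree.\<close>

definition leaf :: "('a, 'b) pre_digraph \<Rightarrow> 'a \<Rightarrow> bool" where
  "leaf G x \<longleftrightarrow> x \<in> verts G \<and> out_degree G x = 1"

text \<open>
  A path is given by its list of vertices; \<open>path_graph p\<close> is the path as a graph of its own, so that
  its center is taken with respect to distances along the path.
\<close>

definition path_graph :: "'a list \<Rightarrow> 'a pair_pre_digraph" where
  "path_graph p = \<lparr> pverts = set p, parcs = set (vwalk_arcs p) \<union> (set (vwalk_arcs p))\<inverse> \<rparr>"

definition longest_path :: "('a, 'b) pre_digraph \<Rightarrow> 'a list \<Rightarrow> bool" where
  "longest_path G p \<longleftrightarrow> vpath p G \<and> (\<forall>q. vpath q G \<longrightarrow> length q \<le> length p)"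

definition extremal1 :: "('a, 'b) pre_digraph \<Rightarrow> 'a \<Rightarrow> 'a \<Rightarrow> bool" where
  "extremal1 G u v \<longleftrightarrow> (\<exists>p. longest_path G p \<and> length p = card (verts G) - 1 \<and>
     verts G - set p = {u} \<and> u \<rightarrow>\<^bsub>G\<^esub> v \<and> v \<in> center (with_proj (path_graph p)))"

text \<open>Lists are indexed from 0, so the vertex \<open>z\<^sub>j\<close> of the path is \<open>p ! (j - 1)\<close>.\<close>

definition extremal2 :: "('a, 'b) pre_digraph \<Rightarrow> 'a \<Rightarrow> 'a \<Rightarrow> bool" where
  "extremal2 G u v \<longleftrightarrow> even (card (verts G)) \<and>
     (\<exists>p w. longest_path G p \<and> length p = card (verts G) - 2 \<and>
       verts G - set p = {u, w} \<and> u \<noteq> w \<and>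
       u \<rightarrow>\<^bsub>G\<^esub> v \<and> v \<in> center (with_proj (path_graph p)) \<and>
       leaf G w \<and> (\<exists>j \<in> {2..card (verts G) - 3}. w \<rightarrow>\<^bsub>G\<^esub> p ! (j - 1)))"

end

theory Submission
  imports Defs
begin

text \<open>
  In a tree every path is geodesic. Hence, if \<open>p\<close> is a longest path, of length \<open>L\<close>, a vertex off \<open>p\<close>
  at distance \<open>k \<ge> 1\<close> from \<open>p\<close> with nearest vertex \<open>p ! j\<close> has distance \<open>k + \<bar>i - j\<bar>\<close> to \<open>p ! i\<close>, and
  maximality of \<open>p\<close> gives \<open>k \<le> min j (L - j)\<close>. So \<open>p ! i\<close> has eccentricity \<open>max i (L - i)\<close>, the radius is
  \<open>r = \<lceil>L / 2\<rceil>\<close>, and every center vertex lies on \<open>p\<close>. The eccentricity of a leaf is one more than that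
  of its neighbour, hence at least \<open>r + 1\<close>. With \<open>m = \<lfloor>(n - 1) / 2\<rfloor>\<close> the lower bound follows from
  \<open>r \<le> m\<close>, which fails only for paths with \<open>n\<close> even. Equality forces \<open>r = m\<close> and leaf eccentricity
  \<open>m + 1\<close>, so that \<open>p\<close> misses one vertex, or two with \<open>n\<close> even. The leaf is then off \<open>p\<close> with a center
  vertex as neighbour, unless \<open>L = 3\<close>, where any vertex off \<open>p\<close> can take its place.
\<close>

section \<open>Walks and distances\<close>

lemma length_vwalk_to_vpath_le: "length (vwalk_to_vpath xs) \<le> length xs"
proof (induct xs rule: vwalk_to_vpath_induct3)
  case (in_set x xs)
  then show ?case
    using length_dropWhile_le[of "\<lambda>y. y \<noteq> x" xs] by simp
qed simp_all

text \<open>Bridge between the two encodings: \<open>graph_dist\<close> counts the arcs of arc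
  walks, while paths are lists of vertices. An arc is chosen for each consecutive pair.\<close>

lemma (in wf_digraph) vwalk_imp_awalk:
  assumes "vwalk p G"
  shows "\<exists>q. awalk (hd p) q (last p) \<and> awalk_verts (hd p) q = p"
  using assms
proof (induct p rule: vwalk_induct)
  case (Base u)
  then show ?case by (intro exI[of _ "[]"]) (auto simp: awalk_simps)
next
  case (Cons u v es)
  then obtain q where q: "awalk v q (last (v # es))" "awalk_verts v q = v # es" by auto
  from Cons obtain e where e: "e \<in> arcs G" "tail G e = u" "head G e = v" by auto
  show ?case
    using q e by (intro exI[of _ "e # q"]) (auto simp: awalk_simps)
qed

lemma (in wf_digraph) graph_dist_le_vwalk:
  assumes "vwalk p G"
  shows "graph_dist G (hd p) (last p) \<le> length p - 1"
proof -
  obtain q where q: "awalk (hd p) q (last p)" "awalk_verts (hd p) q = p"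
    using vwalk_imp_awalk[OF assms] by blast
  then have "length q = length p - 1"
    by (metis add_diff_cancel_right' length_awalk_verts Suc_eq_plus1)
  with q show ?thesis
    unfolding graph_dist_def by (intro Least_le) blast
qed

text \<open>Cutting the loops out of a shortest walk does not lengthen it, and minimality of the
  distance forbids shortening it, so the resulting path has exactly the right length.\<close>

lemma (in wf_digraph) shortest_vpath:
  assumes "u \<rightarrow>\<^sup>* v"
  obtains p where "vpath p G" "hd p = u" "last p = v" "length p = Suc (graph_dist G u v)"
proof -
  from assms obtain q where "awalk u q v" by (auto simp: reachable_awalk)
  then have "\<exists>p. awalk u p v \<and> length p = graph_dist G u v"
    unfolding graph_dist_def
    using LeastI_ex[of "\<lambda>k. \<exists>p. awalk u p v \<and> length p = k"] by blast
  then obtain p where p: "awalk u p v" "length p = graph_dist G u v" by blast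
  let ?w = "awalk_verts u p"
  let ?r = "vwalk_to_vpath ?w"
  have w: "vwalk ?w G" "hd ?w = u" "last ?w = v" "length ?w = Suc (graph_dist G u v)"
    using p awalk_imp_vwalk by (auto simp: length_awalk_verts)
  have r: "vpath ?r G" "hd ?r = u" "last ?r = v" "length ?r \<le> Suc (graph_dist G u v)"
    using w vwalk_to_vpath_vpath[OF w(1)] length_vwalk_to_vpath_le[of ?w]
    by (auto simp: vwalk_to_vpath_hd vwalk_to_vpath_last)
  have "graph_dist G u v \<le> length ?r - 1"
    using graph_dist_le_vwalk[of ?r] r by auto
  moreover have "length ?r > 0" using r(1) by auto
  ultimately have "length ?r = Suc (graph_dist G u v)" using r(4) by linarith
  then show thesis using that[OF r(1-3)] by blast
qed

lemma vpath_rev: "symmetric G \<Longrightarrow> vpath p G \<Longrightarrow> vpath (rev p) G"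
  by (auto simp: vpath_def intro: vwalk_rev_ex)

lemma vwalk_join:
  assumes "vwalk p G" "vwalk q G" "last p = hd q"
  shows "vwalk (p @ tl q) G" "hd (p @ tl q) = hd p" "last (p @ tl q) = last q"
    "length (p @ tl q) = length p + length q - 1"
proof -
  have ne: "p \<noteq> []" "q \<noteq> []" using assms by auto
  show "vwalk (p @ tl q) G"
    using vwalk_joinI_vwalk'[OF assms] by (simp add: vwalk_join_def)
  show "hd (p @ tl q) = hd p" "length (p @ tl q) = length p + length q - 1"
    using ne by (auto simp: Suc_le_eq)
  show "last (p @ tl q) = last q"
    using ne assms(3) by (cases q) auto
qed

lemma vpath_slice:
  assumes "vpath p G" "i \<le> j" "j < length p"
  shows "vpath (take (Suc j - i) (drop i p)) G" "hd (take (Suc j - i) (drop i p)) = p ! i"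
    "last (take (Suc j - i) (drop i p)) = p ! j" "length (take (Suc j - i) (drop i p)) = Suc (j - i)"
proof -
  let ?s = "take (Suc j - i) (drop i p)"
  have ne: "?s \<noteq> []" using assms by auto
  have "p = take i p @ ?s @ drop (Suc j - i) (drop i p)" by (simp del: drop_drop)
  then have "vwalk (?s @ drop (Suc j - i) (drop i p)) G"
    using assms(1) ne vwalkI_append_r[of "?s @ drop (Suc j - i) (drop i p)" "take i p"]
    by (metis append_is_Nil_conv vpathE)
  then show "vpath ?s G"
    using vwalkI_append_l[OF ne] assms(1) by (auto simp: vpath_def)
  show "length ?s = Suc (j - i)" using assms by auto
  then show "hd ?s = p ! i" "last ?s = p ! j"
    using assms ne by (auto simp: hd_conv_nth last_conv_nth)
qed

section \<open>Eccentricities in connected graphs\<close>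

locale connected_graph = graph G for G (structure) +
  assumes reach: "x \<in> verts G \<Longrightarrow> y \<in> verts G \<Longrightarrow> x \<rightarrow>\<^sup>* y"
begin

lemma shortest:
  assumes "x \<in> verts G" "y \<in> verts G"
  obtains p where "vpath p G" "hd p = x" "last p = y" "length p = Suc (graph_dist G x y)"
  using shortest_vpath[OF reach[OF assms]] by blast

lemma dist_self: "x \<in> verts G \<Longrightarrow> graph_dist G x x = 0"
  using graph_dist_le_vwalk[of "[x]"] by simp

lemma dist_adj_le: "x \<rightarrow>\<^bsub>G\<^esub> y \<Longrightarrow> graph_dist G x y \<le> 1"
  using graph_dist_le_vwalk[of "[x, y]"] adj_in_verts by (auto simp: vwalk_def)

lemma dist_eq_0D:
  assumes "x \<in> verts G" "y \<in> verts G" "graph_dist G x y = 0" shows "x = y"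
proof -
  obtain p where "hd p = x" "last p = y" "length p = 1"
    using shortest[OF assms(1,2)] assms(3) by (metis One_nat_def)
  then show ?thesis by (cases p) auto
qed

lemma dist_eq_1D:
  assumes "x \<in> verts G" "y \<in> verts G" "graph_dist G x y = 1" shows "x \<rightarrow>\<^bsub>G\<^esub> y"
proof -
  obtain p where p: "vpath p G" "hd p = x" "last p = y" "length p = 2"
    using shortest[OF assms(1,2)] assms(3) by (metis One_nat_def Suc_1)
  then obtain a b where "p = [a, b]" by (auto simp: length_Suc_conv numeral_2_eq_2)
  with p show ?thesis by (auto simp: vpath_def)
qed

lemma dist_triangle:
  assumes "x \<in> verts G" "y \<in> verts G" "z \<in> verts G"
  shows "graph_dist G x z \<le> graph_dist G x y + graph_dist G y z"
proof -
  obtain p where p: "vpath p G" "hd p = x" "last p = y" "length p = Suc (graph_dist G x y)"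
    using shortest[OF assms(1,2)] .
  obtain q where q: "vpath q G" "hd q = y" "last q = z" "length q = Suc (graph_dist G y z)"
    using shortest[OF assms(2,3)] .
  have w: "vwalk p G" "vwalk q G" "last p = hd q" using p q by auto
  show ?thesis
    using graph_dist_le_vwalk[OF vwalk_join(1)[OF w]] vwalk_join(2-4)[OF w] p q by simp
qed

lemma dist_sym_le:
  assumes "x \<in> verts G" "y \<in> verts G"
  shows "graph_dist G x y \<le> graph_dist G y x"
proof -
  obtain p where p: "vpath p G" "hd p = y" "last p = x" "length p = Suc (graph_dist G y x)"
    using shortest[OF assms(2,1)] .
  then have "vwalk (rev p) G" "p \<noteq> []" using vpath_rev[OF sym_arcs] by auto
  then show ?thesis
    using graph_dist_le_vwalk[of "rev p"] p by (simp add: hd_rev last_rev)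
qed

lemma dist_sym:
  "x \<in> verts G \<Longrightarrow> y \<in> verts G \<Longrightarrow> graph_dist G x y = graph_dist G y x"
  by (intro antisym dist_sym_le)

lemma adj_sym: "x \<rightarrow>\<^bsub>G\<^esub> y \<Longrightarrow> y \<rightarrow>\<^bsub>G\<^esub> x"
  using arcs_ends_symmetric[OF sym_arcs] .

lemma dist_le_ecc: "y \<in> verts G \<Longrightarrow> graph_dist G x y \<le> ecc G x"
  unfolding ecc_def by (intro Max_ge) auto

lemma ecc_attained:
  assumes "x \<in> verts G" obtains y where "y \<in> verts G" "ecc G x = graph_dist G x y"
proof -
  have "ecc G x \<in> graph_dist G x ` verts G"
    unfolding ecc_def using assms by (intro Max_in) auto
  then show thesis using that by auto
qed

lemma ecc_leI:
  assumes "x \<in> verts G" "\<And>y. y \<in> verts G \<Longrightarrow> graph_dist G x y \<le> k"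
  shows "ecc G x \<le> k"
  by (metis assms ecc_attained)

text \<open>Any route from \<open>x\<close> may be taken through \<open>y\<close>, and both legs are
  at most \<open>ecc G y\<close>. This is the whole upper bound.\<close>

lemma ecc_le_double:
  assumes "x \<in> verts G" "y \<in> verts G" shows "ecc G x \<le> 2 * ecc G y"
proof (rule ecc_leI[OF assms(1)])
  fix z assume z: "z \<in> verts G"
  show "graph_dist G x z \<le> 2 * ecc G y"
    using dist_triangle[OF assms z] dist_sym[OF assms] dist_le_ecc[OF z, of y]
      dist_le_ecc[OF assms(1), of y] by simp
qed

text \<open>Without parallel arcs, \<open>head G\<close> maps the arcs out of \<open>x\<close>
  bijectively to its neighbours.\<close>

lemma leaf_iff_unique_neighbour: "leaf G x \<longleftrightarrow> x \<in> verts G \<and> (\<exists>!y. x \<rightarrow>\<^bsub>G\<^esub> y)"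
proof -
  have "bij_betw (head G) (out_arcs G x) {y. x \<rightarrow>\<^bsub>G\<^esub> y}"
  proof (rule bij_betw_imageI)
    show "inj_on (head G) (out_arcs G x)"
      by (rule inj_onI) (auto intro!: no_multi_arcs simp: arc_to_ends_def)
    show "head G ` out_arcs G x = {y. x \<rightarrow>\<^bsub>G\<^esub> y}"
      by (auto simp: arcs_ends_conv image_iff)
  qed
  then have "out_degree G x = card {y. x \<rightarrow>\<^bsub>G\<^esub> y}"
    unfolding out_degree_def by (rule bij_betw_same_card)
  moreover have "card {y. x \<rightarrow>\<^bsub>G\<^esub> y} = 1 \<longleftrightarrow> (\<exists>!y. x \<rightarrow>\<^bsub>G\<^esub> y)"
    by (auto simp: card_1_singleton_iff set_eq_iff)
  ultimately show ?thesis by (simp add: leaf_def)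
qed

text \<open>Every path that leaves a leaf passes through its only neighbour.\<close>

lemma dist_leaf:
  assumes "leaf G x" "x \<rightarrow>\<^bsub>G\<^esub> y" "z \<in> verts G" "z \<noteq> x"
  shows "graph_dist G x z = Suc (graph_dist G y z)"
proof (rule antisym)
  have V: "x \<in> verts G" "y \<in> verts G" using assms(2) adj_in_verts by auto
  show "graph_dist G x z \<le> Suc (graph_dist G y z)"
    using dist_triangle[OF V assms(3)] dist_adj_le[OF assms(2)] by simp
  obtain p where p: "vpath p G" "hd p = x" "last p = z" "length p = Suc (graph_dist G x z)"
    using shortest[OF V(1) assms(3)] .
  then obtain a q where q: "p = x # a # q" using assms(4)
    by (cases p; cases "tl p") auto
  then have "x \<rightarrow>\<^bsub>G\<^esub> a" "vwalk (a # q) G" using p(1) by (auto simp: vpath_def)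
  moreover have "a = y" using assms(1,2) \<open>x \<rightarrow>\<^bsub>G\<^esub> a\<close> unfolding leaf_iff_unique_neighbour by blast
  ultimately show "Suc (graph_dist G y z) \<le> graph_dist G x z"
    using graph_dist_le_vwalk[of "a # q"] p q by simp
qed

lemma ecc_leaf:
  assumes "leaf G x" "x \<rightarrow>\<^bsub>G\<^esub> y" "3 \<le> card (verts G)"
  shows "ecc G x = Suc (ecc G y)"
proof (rule antisym)
  have V: "x \<in> verts G" "y \<in> verts G" using assms(2) adj_in_verts by auto
  have d: "graph_dist G x z = Suc (graph_dist G y z)" if "z \<in> verts G" "z \<noteq> x" for z
    using dist_leaf[OF assms(1,2) that] .
  show "ecc G x \<le> Suc (ecc G y)"
  proof (rule ecc_leI[OF V(1)])
    fix z assume z: "z \<in> verts G"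
    then show "graph_dist G x z \<le> Suc (ecc G y)"
      using d[OF z] dist_self[OF V(1)] dist_le_ecc[OF z, of y] by (cases "z = x") auto
  qed
  show "Suc (ecc G y) \<le> ecc G x"
  proof -
    obtain z where z: "z \<in> verts G" "ecc G y = graph_dist G y z"
      using ecc_attained[OF V(2)] .
    \<comment> \<open>A vertex farthest from \<open>y\<close> may be the leaf \<open>x\<close>
      itself, to which \<open>dist_leaf\<close> does not apply. Then \<open>ecc G y\<close> is at
      most 1, and a third vertex is just as far from \<open>y\<close>; in a single edge this
      fails.\<close>
    have "\<exists>z' \<in> verts G. z' \<noteq> x \<and> ecc G y \<le> graph_dist G y z'"
    proof (cases "z = x")
      case True
      have "\<not> verts G \<subseteq> {x, y}"
      proof
        assume "verts G \<subseteq> {x, y}"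
        then have "card (verts G) \<le> card {x, y}" by (intro card_mono) auto
        also have "\<dots> \<le> 2" by (simp add: card_insert_if)
        finally show False using assms(3) by simp
      qed
      then obtain z' where z': "z' \<in> verts G" "z' \<noteq> x" "z' \<noteq> y" by blast
      have "ecc G y \<le> 1" using dist_adj_le[OF adj_sym[OF assms(2)]] z True by simp
      moreover have "graph_dist G y z' \<noteq> 0" using dist_eq_0D[OF V(2) z'(1)] z' by auto
      ultimately show ?thesis using z' by (intro bexI[of _ z']) auto
    qed (use z in auto)
    then show ?thesis using d dist_le_ecc[of _ x] by (metis Suc_le_mono le_trans)
  qed
qed

end

section \<open>Distances in trees\<close>

lemma vpath_join:
  assumes "vpath p G" "vpath q G" "last p = hd q" "set p \<inter> set q \<subseteq> {hd q}"
  shows "vpath (p @ tl q) G"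
proof -
  have "distinct (p @ tl q)"
    using assms by (cases q) (auto simp: vpath_def)
  then show ?thesis
    using vwalk_join(1)[of p G q] assms by (auto simp: vpath_def)
qed

text \<open>Acyclicity in terms of vertices: a path on at least three vertices together with an arc
  from its end to its start would be a cycle of length at least 3.\<close>

locale tree_graph = connected_graph +
  assumes no_closing_arc: "vpath p G \<Longrightarrow> 3 \<le> length p \<Longrightarrow> \<not> last p \<rightarrow>\<^bsub>G\<^esub> hd p"
begin

lemma adj_dist: "x \<rightarrow>\<^bsub>G\<^esub> y \<Longrightarrow> graph_dist G x y = 1"
  using dist_adj_le[of x y] dist_eq_0D[of x y] adj_in_verts[of x y] adj_not_same
  by (cases "graph_dist G x y") auto

text \<open>If the two paths leave \<open>x\<close> through different neighbours, following
  \<open>p\<close> to the common end and \<open>q'\<close> backwards gives a walk between these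
  neighbours that avoids \<open>x\<close>. Shortened to a path and extended by \<open>x\<close>, it
  has at least three vertices and is closed by the arc from \<open>hd q'\<close> to
  \<open>x\<close>.\<close>

lemma vpath_unique:
  assumes "vpath p G" "vpath q G" "hd p = hd q" "last p = last q"
  shows "p = q"
  using assms
proof (induct p arbitrary: q)
  case Nil
  then show ?case by auto
next
  case (Cons x p)
  then obtain q' where q: "q = x # q'" by (cases q) auto
  have x: "x \<notin> set p" "x \<notin> set q'" "x \<in> verts G"
    using Cons.prems q by (auto simp: vpath_def vwalk_def)
  show ?case
  proof (cases "p = [] \<or> q' = []")
    case True
    then show ?thesis
      using Cons.prems(4) q x last_in_set[of p] last_in_set[of q'] by (auto split: if_splits)
  next
    case False
    then have p: "vpath p G" "x \<rightarrow>\<^bsub>G\<^esub> hd p" and q': "vpath q' G" "x \<rightarrow>\<^bsub>G\<^esub> hd q'"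
      using Cons.prems q by (auto simp: vpath_def elim: vwalk_consE)
    have last: "last p = last q'" using Cons.prems(4) q False by simp
    show ?thesis
    proof (cases "hd p = hd q'")
      case True
      then show ?thesis using Cons.hyps[OF p(1) q'(1)] last q by simp
    next
      case neq: False
      let ?w = "p @ tl (rev q')"
      let ?r = "vwalk_to_vpath ?w"
      have rev: "vwalk p G" "vwalk (rev q') G" "last p = hd (rev q')"
        using p(1) vpath_rev[OF sym_arcs q'(1)] last False by (auto simp: hd_rev)
      have w: "vwalk ?w G" "hd ?w = hd p" "last ?w = hd q'"
        using vwalk_join[OF rev] False by (auto simp: last_rev)
      have r: "vpath ?r G" "hd ?r = hd p" "last ?r = hd q'"
        using vwalk_to_vpath_vpath[OF w(1)] w(2,3)
        by (simp_all only: vwalk_to_vpath_hd vwalk_to_vpath_last)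
      have "x \<notin> set ?w" using x list.set_sel(2)[of "rev q'" x] False by auto
      then have "x \<notin> set ?r" using vwalk_to_vpath_subset by metis
      then have "vpath (x # ?r) G"
        using r(1,2) p(2) x(3) by (auto simp: vpath_def intro: vwalk_consI)
      moreover have "?r \<noteq> []" using r(1) by (auto simp: vpath_def)
      moreover have "length ?r \<noteq> 1" using r(2,3) neq by (cases ?r) auto
      ultimately show ?thesis
        using no_closing_arc[of "x # ?r"] r(3) adj_sym[OF q'(2)]
        by (cases ?r; cases "tl ?r") auto
    qed
  qed
qed

text \<open>By uniqueness the path coincides with a shortest one between its ends.\<close>

lemma vpath_geodesic:
  assumes "vpath p G" shows "length p = Suc (graph_dist G (hd p) (last p))"
proof -
  have V: "hd p \<in> verts G" "last p \<in> verts G"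
    using assms hd_in_set[of p] last_in_set[of p] by (auto simp: vpath_def vwalk_def)
  obtain q where q: "vpath q G" "hd q = hd p" "last q = last p"
    "length q = Suc (graph_dist G (hd p) (last p))"
    using shortest[OF V] .
  with vpath_unique[OF assms q(1)] show ?thesis by simp
qed

lemma dist_on_vpath_le:
  assumes "vpath p G" "i \<le> j" "j < length p"
  shows "graph_dist G (p ! i) (p ! j) = j - i"
  using vpath_geodesic[OF vpath_slice(1)[OF assms]] vpath_slice(2-4)[OF assms] by simp

lemma nth_vpath_in_verts: "vpath p G \<Longrightarrow> i < length p \<Longrightarrow> p ! i \<in> verts G"
  by (auto simp: vpath_def vwalk_def)

text \<open>On \<open>nat\<close>, \<open>(i - j) + (j - i)\<close> is the absolute difference.\<close>

lemma dist_on_vpath: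
  assumes "vpath p G" "i < length p" "j < length p"
  shows "graph_dist G (p ! i) (p ! j) = (i - j) + (j - i)"
proof (cases "i \<le> j")
  case True
  then show ?thesis using dist_on_vpath_le[OF assms(1) True assms(3)] by simp
next
  case False
  then show ?thesis
    using dist_on_vpath_le[OF assms(1) _ assms(2), of j]
      dist_sym[OF nth_vpath_in_verts[OF assms(1,2)] nth_vpath_in_verts[OF assms(1,3)]] by simp
qed

text \<open>Here \<open>p ! j\<close> is a vertex of \<open>p\<close> nearest to \<open>x\<close>
  and \<open>k\<close> is its distance. A shortest path to it, continued along \<open>p\<close> in
  either direction, is still a path and hence geodesic.\<close>

lemma projection_onto_vpath:
  assumes p: "vpath p G" and x: "x \<in> verts G" "x \<notin> set p"
  obtains k j where "1 \<le> k" "j < length p"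
    "\<And>i. i < length p \<Longrightarrow> graph_dist G x (p ! i) = k + ((i - j) + (j - i))"
proof -
  have "p \<noteq> []" using p by (auto simp: vpath_def)
  then obtain j where j: "j < length p"
    and min: "\<And>i. i < length p \<Longrightarrow> graph_dist G x (p ! j) \<le> graph_dist G x (p ! i)"
    using ex_has_least_nat[of "\<lambda>i. i < length p" 0 "\<lambda>i. graph_dist G x (p ! i)"] by auto
  let ?k = "graph_dist G x (p ! j)"
  have pj: "p ! j \<in> verts G" using nth_vpath_in_verts[OF p j] .
  obtain s where s: "vpath s G" "hd s = x" "last s = p ! j" "length s = Suc ?k"
    using shortest[OF x(1) pj] .
  \<comment> \<open>The vertex at position \<open>t\<close> of \<open>s\<close> has distance
    \<open>t\<close> from \<open>x\<close>. If it lies on \<open>p\<close>, minimality gives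
    \<open>t = ?k\<close>, so it is the last vertex of \<open>s\<close>.\<close>
  have s_p: "set s \<inter> set p \<subseteq> {p ! j}"
  proof
    fix y assume y: "y \<in> set s \<inter> set p"
    then obtain t i where t: "t < length s" "y = s ! t" and i: "i < length p" "y = p ! i"
      by (metis IntE in_set_conv_nth)
    have "s \<noteq> []" using s(4) by auto
    then have "graph_dist G x y = t"
      using dist_on_vpath_le[OF s(1) _ t(1), of 0] s(2) t(2) by (simp add: hd_conv_nth)
    then have "t = ?k" using min[OF i(1)] i(2) t(1) s(4) by simp
    then show "y \<in> {p ! j}" using s(3,4) t(2) \<open>s \<noteq> []\<close> by (simp add: last_conv_nth)
  qed
  \<comment> \<open>\<open>q\<close> stands for a stretch of \<open>p\<close> starting at
    \<open>p ! j\<close>; it is used for a slice to the right and for a reversed slice to the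
    left.\<close>
  have branch: "graph_dist G x (last q) = ?k + (length q - 1)"
    if q: "vpath q G" "hd q = p ! j" "set q \<subseteq> set p" for q
  proof -
    have "vpath (s @ tl q) G"
      using vpath_join[OF s(1) q(1)] s(3) q(2,3) s_p by auto
    moreover have "vwalk s G" "vwalk q G" "last s = hd q" using s q by auto
    note vwalk_join(2-4)[OF this]
    ultimately show ?thesis
      using vpath_geodesic[of "s @ tl q"] s(2,4) by simp
  qed
  have "graph_dist G x (p ! i) = ?k + ((i - j) + (j - i))" if i: "i < length p" for i
  proof (cases "j \<le> i")
    case True
    note sl = vpath_slice[OF p True i]
    show ?thesis
      using branch[OF sl(1,2)] sl(3,4) True by (auto dest: in_set_takeD in_set_dropD)
  next
    case False
    then have le: "i \<le> j" by simp
    note sl = vpath_slice[OF p le j]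
    let ?q = "rev (take (Suc j - i) (drop i p))"
    have "hd ?q = p ! j" "last ?q = p ! i" "length ?q = Suc (j - i)"
      using sl(2-4) by (simp_all only: hd_rev last_rev length_rev)
    moreover have "set ?q \<subseteq> set p" by (auto dest: in_set_takeD in_set_dropD)
    ultimately show ?thesis
      using branch[OF vpath_rev[OF sym_arcs sl(1)]] le by simp
  qed
  moreover have "1 \<le> ?k"
    using dist_eq_0D[OF x(1) pj] x(2) j by (cases ?k) auto
  ultimately show thesis using that j by blast
qed

text \<open>A neighbour \<open>p ! i\<close> has distance 1, which must equal \<open>k\<close> plus
  the absolute difference of \<open>i\<close> and \<open>j\<close> with \<open>k\<close> at least 1.
  This forces \<open>i = j\<close>.\<close>

lemma off_path_neighbour_unique:
  assumes "vpath p G" "x \<notin> set p" "x \<rightarrow>\<^bsub>G\<^esub> y" "y \<in> set p" "x \<rightarrow>\<^bsub>G\<^esub> z" "z \<in> set p"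
  shows "y = z"
proof -
  have x: "x \<in> verts G" using assms(3) adj_in_verts by blast
  obtain k j where k: "1 \<le> k" "j < length p"
    "\<And>i. i < length p \<Longrightarrow> graph_dist G x (p ! i) = k + ((i - j) + (j - i))"
    using projection_onto_vpath[OF assms(1) x assms(2)] by blast
  have "w = p ! j" if w: "x \<rightarrow>\<^bsub>G\<^esub> w" "w \<in> set p" for w
  proof -
    obtain i where i: "i < length p" "w = p ! i" using w(2) by (metis in_set_conv_nth)
    then have "i = j" using adj_dist[OF w(1)] k(1) k(3)[OF i(1)] by auto
    with i show ?thesis by simp
  qed
  then show ?thesis using assms by blast
qed

lemma longest_path_ex:
  assumes "verts G \<noteq> {}" obtains p where "longest_path G p"
proof -
  obtain x where "x \<in> verts G" using assms by blast
  then have "vpath [x] G" by (rule vpath_self)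
  moreover have "finite (length ` {p. vpath p G})" using vpaths_finite by blast
  ultimately have "Max (length ` {p. vpath p G}) \<in> length ` {p. vpath p G}"
    by (intro Max_in) auto
  then obtain p where "vpath p G" "length p = Max (length ` {p. vpath p G})" by auto
  then have "longest_path G p"
    unfolding longest_path_def using vpaths_finite by auto
  then show thesis using that by blast
qed

end

section \<open>Eccentricities relative to a longest path\<close>

context
  fixes G :: "('a, 'b) pre_digraph" (structure) and p :: "'a list" and L :: nat
  assumes tree: "tree_graph G" and longest: "longest_path G p" and len: "length p = Suc L"
begin

interpretation tree_graph G by (rule tree)

lemma longest_vpath: "vpath p G"
  using longest by (simp add: longest_path_def)

lemma dist_le_longest:
  assumes "x \<in> verts G" "y \<in> verts G" shows "graph_dist G x y \<le> L"
proof -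
  obtain q where "vpath q G" "length q = Suc (graph_dist G x y)" using shortest[OF assms] by blast
  then show ?thesis using longest len by (metis Suc_le_mono longest_path_def)
qed

text \<open>The distances \<open>k + j\<close> and \<open>k + (L - j)\<close> to the two ends of
  \<open>p\<close> cannot exceed \<open>L\<close>.\<close>

lemma projection_onto_longest_path:
  assumes "x \<in> verts G" "x \<notin> set p"
  obtains k j where "1 \<le> k" "k \<le> j" "j + k \<le> L"
    "\<And>i. i \<le> L \<Longrightarrow> graph_dist G x (p ! i) = k + ((i - j) + (j - i))"
proof -
  obtain k j where k: "1 \<le> k" "j < length p"
    "\<And>i. i < length p \<Longrightarrow> graph_dist G x (p ! i) = k + ((i - j) + (j - i))"
    using projection_onto_vpath[OF longest_vpath assms] by blast
  have V: "p ! 0 \<in> verts G" "p ! L \<in> verts G"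
    using nth_vpath_in_verts[OF longest_vpath] len by auto
  have "k + j \<le> L" "k + (L - j) \<le> L"
    using dist_le_longest[OF assms(1) V(1)] dist_le_longest[OF assms(1) V(2)] k(2)
      k(3)[of 0] k(3)[of L] len by auto
  then show thesis using that[of k j] k len by auto
qed

text \<open>The ends of \<open>p\<close> give the lower bound. A branch leaving \<open>p\<close> at
  \<open>p ! j\<close> is no deeper than either end is far from \<open>p ! j\<close>, so nothing on
  it is farther from \<open>p ! i\<close> than the end of \<open>p\<close> beyond
  \<open>p ! j\<close>.\<close>

lemma ecc_on_longest_path:
  assumes "i \<le> L" shows "ecc G (p ! i) = max i (L - i)"
proof (rule antisym)
  have V: "p ! j \<in> verts G" if "j \<le> L" for j
    using nth_vpath_in_verts[OF longest_vpath] len that by auto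
  have d: "graph_dist G (p ! i) (p ! j) = (i - j) + (j - i)" if "j \<le> L" for j
    using dist_on_vpath[OF longest_vpath] assms that len by simp
  show "max i (L - i) \<le> ecc G (p ! i)"
    using d[of 0] d[of L] dist_le_ecc[OF V, of 0 "p ! i"] dist_le_ecc[OF V, of L "p ! i"] assms
    by auto
  show "ecc G (p ! i) \<le> max i (L - i)"
  proof (rule ecc_leI[OF V[OF assms]])
    fix x assume x: "x \<in> verts G"
    show "graph_dist G (p ! i) x \<le> max i (L - i)"
    proof (cases "x \<in> set p")
      case True
      then obtain j where "j \<le> L" "x = p ! j" using len by (metis in_set_conv_nth less_Suc_eq_le)
      then show ?thesis using d[of j] by auto
    next
      case False
      obtain k j where k: "k \<le> j" "j + k \<le> L"
        "graph_dist G x (p ! i) = k + ((i - j) + (j - i))"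
        using projection_onto_longest_path[OF x False] assms by metis
      then show ?thesis using dist_sym[OF x V[OF assms]] by auto
    qed
  qed
qed

text \<open>The distances to the two ends of \<open>p\<close> add up to \<open>L + 2 * k\<close>,
  and the larger one is at least half of that. Such a vertex thus exceeds the radius.\<close>

lemma ecc_off_longest_path:
  assumes "x \<in> verts G" "x \<notin> set p" shows "L + 2 \<le> 2 * ecc G x"
proof -
  obtain k j where k: "1 \<le> k" "j + k \<le> L"
    "\<And>i. i \<le> L \<Longrightarrow> graph_dist G x (p ! i) = k + ((i - j) + (j - i))"
    using projection_onto_longest_path[OF assms] by metis
  have "p ! 0 \<in> verts G" "p ! L \<in> verts G"
    using nth_vpath_in_verts[OF longest_vpath] len by auto
  then show ?thesis
    using dist_le_ecc[of "p ! 0" x] dist_le_ecc[of "p ! L" x] k(3)[of 0] k(3)[of L] k(1,2) by simp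
qed

lemma ecc_ge_half_longest:
  assumes "x \<in> verts G" shows "(L + 1) div 2 \<le> ecc G x"
proof (cases "x \<in> set p")
  case True
  then obtain j where "j \<le> L" "x = p ! j" using len by (metis in_set_conv_nth less_Suc_eq_le)
  then show ?thesis using ecc_on_longest_path[of j] by auto
next
  case False
  then show ?thesis using ecc_off_longest_path[OF assms] by simp
qed

text \<open>The middle vertex \<open>p ! (L div 2)\<close> attains the lower bound of
  \<open>ecc_ge_half_longest\<close>, so \<open>(L + 1) div 2\<close> is the radius.\<close>

lemma center_iff_ecc: "v \<in> center G \<longleftrightarrow> v \<in> verts G \<and> ecc G v = (L + 1) div 2"
proof -
  have mid: "p ! (L div 2) \<in> verts G" using nth_vpath_in_verts[OF longest_vpath] len by auto
  have ecc: "ecc G (p ! (L div 2)) = (L + 1) div 2"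
    using ecc_on_longest_path[of "L div 2"] by linarith
  show ?thesis
  proof
    assume "v \<in> center G"
    then have "v \<in> verts G" "ecc G v \<le> (L + 1) div 2"
      using mid ecc by (auto simp: center_def)
    then show "v \<in> verts G \<and> ecc G v = (L + 1) div 2"
      using ecc_ge_half_longest[of v] by simp
  next
    assume "v \<in> verts G \<and> ecc G v = (L + 1) div 2"
    then show "v \<in> center G"
      unfolding center_def using ecc_ge_half_longest by simp
  qed
qed

lemma leaf_on_longest_path:
  assumes "leaf G (p ! i)" "i \<le> L" shows "i = 0 \<or> i = L"
proof (rule ccontr)
  assume i: "\<not> ?thesis"
  have "p ! i \<rightarrow>\<^bsub>G\<^esub> p ! (i - 1)" "p ! i \<rightarrow>\<^bsub>G\<^esub> p ! (i + 1)"
    using dist_eq_1D dist_on_vpath[OF longest_vpath] nth_vpath_in_verts[OF longest_vpath]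
      len i assms(2) by auto
  then have "p ! (i - 1) = p ! (i + 1)"
    using assms(1) unfolding leaf_iff_unique_neighbour by blast
  then show False
    using longest_vpath len i assms(2) by (auto simp: vpath_def nth_eq_iff_index_eq)
qed

end

section \<open>The center of a path\<close>

text \<open>The path, as a graph of its own, inherits acyclicity from the tree and is itself a tree
  with longest path \<open>p\<close>. The results on longest paths therefore apply to it as
  well.\<close>

lemma center_path_graph:
  fixes G :: "('a, 'b) pre_digraph"
  assumes "tree_graph G" and p: "vpath p G" "length p = Suc L"
  shows "v \<in> center (with_proj (path_graph p)) \<longleftrightarrow> v \<in> set p \<and> ecc (with_proj (path_graph p)) v = (L + 1) div 2"
    and "i \<le> L \<Longrightarrow> ecc (with_proj (path_graph p)) (p ! i) = max i (L - i)"
proof -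
  interpret tree_graph G by fact
  let ?H = "with_proj (path_graph p)"
  have ends: "arcs_ends ?H \<subseteq> arcs_ends G"
    using p(1) adj_sym by (auto simp: path_graph_def vpath_def vwalk_def)
  have "pair_graph (path_graph p)"
  proof
    show "finite (parcs (path_graph p))" by (simp add: path_graph_def)
    show "symmetric (with_proj (path_graph p))"
      unfolding symmetric_def by (auto simp: path_graph_def sym_def)
    show "fst e \<noteq> snd e" if "e \<in> parcs (path_graph p)" for e
      using that ends adj_not_same by (cases e) auto
  qed (auto simp: path_graph_def elim: in_set_vwalk_arcsE)
  then interpret H: graph ?H by (rule pair_graph.pair_graphD_graph)
  have step: "p ! i \<rightarrow>\<^bsub>?H\<^esub> p ! Suc i" if "Suc i < length p" for i
  proof -
    have "(p ! i, p ! Suc i) \<in> set (vwalk_arcs p)"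
      using that by (induct p arbitrary: i rule: vwalk_arcs.induct) (auto simp: nth_Cons split: nat.split)
    then show ?thesis by (simp add: path_graph_def)
  qed
  have from0: "p ! 0 \<rightarrow>\<^sup>*\<^bsub>?H\<^esub> p ! i" if "i < length p" for i
    using that
  proof (induct i)
    case 0
    then have "p ! 0 \<in> verts ?H" by (simp add: path_graph_def)
    then show ?case by (rule H.reachable_refl)
  next
    case (Suc i)
    then show ?case using H.reachable_adj_trans[OF _ step] by simp
  qed
  have tree: "tree_graph ?H"
  proof
    fix x y assume "x \<in> verts ?H" "y \<in> verts ?H"
    then obtain i j where "i < length p" "x = p ! i" "j < length p" "y = p ! j"
      by (auto simp: path_graph_def in_set_conv_nth)
    then show "x \<rightarrow>\<^sup>*\<^bsub>?H\<^esub> y"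
      using H.reachable_trans[OF symmetric_reachable[OF H.sym_arcs from0] from0] by blast
  next
    fix q assume "vpath q ?H" "3 \<le> length q"
    moreover from this have "vpath q G"
      using ends p(1) by (auto simp: vpath_def vwalk_def path_graph_def)
    ultimately show "\<not> last q \<rightarrow>\<^bsub>?H\<^esub> hd q"
      using no_closing_arc ends by blast
  qed
  have "vpath p ?H"
    using p(1) by (auto simp: vpath_def vwalk_def path_graph_def)
  moreover have "length q \<le> length p" if "vpath q ?H" for q
  proof -
    have "distinct q" "set q \<subseteq> set p" "distinct p"
      using that p(1) by (auto simp: vpath_def vwalk_def path_graph_def)
    then show ?thesis by (metis List.finite_set card_mono distinct_card)
  qed
  ultimately have longest: "longest_path ?H p" by (simp add: longest_path_def)
  show "v \<in> center ?H \<longleftrightarrow> v \<in> set p \<and> ecc ?H v = (L + 1) div 2"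
    using center_iff_ecc[OF tree longest p(2)] by (simp add: path_graph_def)
  show "i \<le> L \<Longrightarrow> ecc ?H (p ! i) = max i (L - i)"
    using ecc_on_longest_path[OF tree longest p(2)] .
qed

section \<open>The extremal trees\<close>

context
  fixes G :: "('a, 'b) pre_digraph" (structure) and p :: "'a list" and L :: nat
  assumes tree: "tree_graph G" and longest: "longest_path G p" and len: "length p = Suc L"
begin

interpretation tree_graph G by (rule tree)

text \<open>Along \<open>p\<close> the eccentricities in the path and in the whole tree agree, both
  being \<open>max i (L - i)\<close> at \<open>p ! i\<close>.\<close>

lemma center_path_graph_iff:
  "v \<in> center (with_proj (path_graph p)) \<longleftrightarrow> v \<in> set p \<and> ecc G v = (L + 1) div 2"
proof -
  note vp = longest_vpath[OF tree longest len]
  have "ecc G v = ecc (with_proj (path_graph p)) v" if v: "v \<in> set p"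
  proof -
    obtain i where "i \<le> L" "v = p ! i" using v len by (metis in_set_conv_nth less_Suc_eq_le)
    then show ?thesis
      by (simp only: ecc_on_longest_path[OF tree longest len] center_path_graph(2)[OF tree vp len])
  qed
  then show ?thesis unfolding center_path_graph(1)[OF tree vp len] by metis
qed

text \<open>With one vertex off \<open>p\<close> this is the first configuration. With two, it
  remains to see that the second one, \<open>w\<close>, is a leaf hanging from an internal vertex of
  \<open>p\<close>.\<close>

lemma leaf_extremal:
  assumes u: "leaf G u" "u \<notin> set p" "u \<rightarrow>\<^bsub>G\<^esub> c" "c \<in> set p" "ecc G c = (L + 1) div 2"
    and n: "card (verts G) = L + 2 \<or> card (verts G) = L + 3 \<and> even (card (verts G))"
  shows "extremal1 G u c \<or> extremal2 G u c"
proof -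
  note vp = longest_vpath[OF tree longest len]
  have pV: "set p \<subseteq> verts G" "distinct p" using vp by (auto simp: vpath_def)
  then have off: "card (verts G - set p) = card (verts G) - Suc L"
    using len by (simp add: card_Diff_subset distinct_card)
  have uV: "u \<in> verts G - set p" using u adj_in_verts by auto
  have cen: "c \<in> center (with_proj (path_graph p))"
    using center_path_graph_iff u by blast
  from n show ?thesis
  proof
    assume n: "card (verts G) = L + 2"
    then have "card (verts G - set p) = 1" using off by simp
    then have "verts G - set p = {u}" using uV by (metis card_1_singletonE singletonD)
    then show ?thesis unfolding extremal1_def using n longest len u(3) cen by auto
  next
    assume n: "card (verts G) = L + 3 \<and> even (card (verts G))"
    then have "card (verts G - set p - {u}) = 1" using off uV by simp
    then obtain w where w: "verts G - set p - {u} = {w}" by (auto simp: card_1_singleton_iff)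
    have wV: "w \<in> verts G" "w \<notin> set p" "w \<noteq> u" and Vw: "verts G - set p = {u, w}"
      using w uV by auto
    obtain k j where k: "1 \<le> k" "k \<le> j" "j + k \<le> L"
      "\<And>i. i \<le> L \<Longrightarrow> graph_dist G w (p ! i) = k + ((i - j) + (j - i))"
      using projection_onto_longest_path[OF tree longest len wV(1,2)] by metis
    \<comment> \<open>The only other vertex off \<open>p\<close> is \<open>u\<close>, whose single
      neighbour \<open>c\<close> lies on \<open>p\<close>; so \<open>u\<close> and \<open>w\<close>
      are not adjacent.\<close>
    have nbr: "y \<in> set p" if y: "w \<rightarrow>\<^bsub>G\<^esub> y" for y
    proof -
      have "y \<noteq> u"
        using y adj_sym u(1,3,4) wV(2) unfolding leaf_iff_unique_neighbour by metis
      moreover have "y \<noteq> w" using y adj_not_same by blast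
      ultimately show ?thesis using adj_in_verts[OF y] Vw by blast
    qed
    have pj: "p ! j \<in> verts G" using pV len k by auto
    obtain q where q: "vpath q G" "hd q = w" "last q = p ! j" "length q = Suc (graph_dist G w (p ! j))"
      using shortest[OF wV(1) pj] .
    have "p ! j \<in> set p" using len k by auto
    then have "w \<noteq> p ! j" using wV(2) by auto
    then obtain a q' where "q = w # a # q'" using q
      by (cases q; cases "tl q") auto
    then have a: "w \<rightarrow>\<^bsub>G\<^esub> a" using q(1) by (simp add: vpath_def)
    then have leaf: "leaf G w"
      using off_path_neighbour_unique[OF vp wV(2)] nbr wV(1)
      unfolding leaf_iff_unique_neighbour by blast
    obtain i where i: "i \<le> L" "a = p ! i"
      using nbr[OF a] len by (metis in_set_conv_nth less_Suc_eq_le)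
    have "i = j" using adj_dist[OF a] k(4)[OF i(1)] k(1) i(2) by simp
    \<comment> \<open>List indices start at 0, so the attachment vertex is number
      \<open>j + 1\<close> of the path. The bounds come from \<open>1 \<le> k\<close>,
      \<open>k \<le> j\<close> and \<open>j + k \<le> L\<close>, where
      \<open>L = card (verts G) - 3\<close>.\<close>
    then have "j + 1 \<in> {2..card (verts G) - 3} \<and> w \<rightarrow>\<^bsub>G\<^esub> p ! (j + 1 - 1)"
      using a i(2) k n by auto
    then have "\<exists>j \<in> {2..card (verts G) - 3}. w \<rightarrow>\<^bsub>G\<^esub> p ! (j - 1)" by blast
    moreover have "length p = card (verts G) - 2" using n len by simp
    ultimately have "extremal2 G u c"
      unfolding extremal2_def using n longest u(3) cen Vw wV(3) leaf by blast
    then show ?thesis ..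
  qed
qed

end

section \<open>The extremal configurations attain equality\<close>

context tree_graph begin

text \<open>Both configurations make \<open>u\<close> a leaf: a neighbour of \<open>u\<close> off
  \<open>p\<close> could only be the vertex \<open>w\<close>, but \<open>w\<close> is a leaf already
  attached to \<open>p\<close>. The eccentricity of \<open>u\<close> then exceeds that of its
  neighbour \<open>c\<close>, a center vertex, by one.\<close>

lemma extremal_leaf:
  assumes "extremal1 G u c \<or> extremal2 G u c" and n: "3 \<le> card (verts G)"
  shows "leaf G u" and "v \<in> center G \<Longrightarrow> ecc G v = (card (verts G) - 1) div 2"
    and "ecc G u = Suc ((card (verts G) - 1) div 2)"
proof -
  have tree: "tree_graph G" by unfold_locales
  obtain p where p: "longest_path G p" "u \<rightarrow>\<^bsub>G\<^esub> c" "c \<in> center (with_proj (path_graph p))"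
    and cases: "length p = card (verts G) - 1 \<and> verts G - set p = {u} \<or>
      even (card (verts G)) \<and> length p = card (verts G) - 2 \<and> (\<exists>w. verts G - set p = {u, w} \<and> u \<noteq> w \<and>
        leaf G w \<and> (\<exists>j \<in> {2..card (verts G) - 3}. w \<rightarrow>\<^bsub>G\<^esub> p ! (j - 1)))"
    using assms(1) unfolding extremal1_def extremal2_def by metis
  have vp: "vpath p G" using p(1) by (simp add: longest_path_def)
  then obtain L where len: "length p = Suc L" by (cases p) (auto simp: vpath_def)
  have u: "u \<in> verts G" "u \<notin> set p" using cases by auto
  have c: "c \<in> set p" "ecc G c = (L + 1) div 2"
    using p(3) center_path_graph_iff[OF tree p(1) len] by auto
  have half: "(L + 1) div 2 = (card (verts G) - 1) div 2"
    using cases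
  proof
    assume "length p = card (verts G) - 1 \<and> verts G - set p = {u}"
    then show ?thesis using len n by simp
  next
    assume A: "even (card (verts G)) \<and> length p = card (verts G) - 2 \<and> (\<exists>w. verts G - set p = {u, w} \<and> u \<noteq> w \<and>
        leaf G w \<and> (\<exists>j \<in> {2..card (verts G) - 3}. w \<rightarrow>\<^bsub>G\<^esub> p ! (j - 1)))"
    \<comment> \<open>Here \<open>L + 1\<close> is two less than the order of the tree, and evenness
      makes its half agree with that of the order minus one.\<close>
    then obtain m where "card (verts G) = 2 * m" by blast
    then show ?thesis using A len by simp presburger
  qed
  have nbr: "y \<in> set p" if y: "u \<rightarrow>\<^bsub>G\<^esub> y" for y
  proof (rule ccontr)
    assume y': "y \<notin> set p"
    have "y \<in> verts G" "y \<noteq> u" using y adj_in_verts adj_not_same by auto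
    then have "y \<in> verts G - set p" using y' by blast
    with cases \<open>y \<noteq> u\<close> obtain j where j: "leaf G y" "2 \<le> j" "j \<le> card (verts G) - 3" "y \<rightarrow>\<^bsub>G\<^esub> p ! (j - 1)"
      "length p = card (verts G) - 2" by (metis atLeastAtMost_iff insertE singletonD)
    then have "p ! (j - 1) = u" using adj_sym[OF y] unfolding leaf_iff_unique_neighbour by blast
    moreover have "p ! (j - 1) \<in> set p" using j by auto
    ultimately show False using u by simp
  qed
  show leaf: "leaf G u"
    using off_path_neighbour_unique[OF vp u(2)] nbr u(1) p(2)
    unfolding leaf_iff_unique_neighbour by blast
  show "v \<in> center G \<Longrightarrow> ecc G v = (card (verts G) - 1) div 2"
    using center_iff_ecc[OF tree p(1) len] half by simp
  show "ecc G u = Suc ((card (verts G) - 1) div 2)"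
    using ecc_leaf[OF leaf p(2) n] c half by simp
qed

end

section \<open>Equality forces an extremal configuration\<close>

context
  fixes G :: "('a, 'b) pre_digraph" (structure) and p :: "'a list" and L :: nat
  assumes tree: "tree_graph G" and longest: "longest_path G p" and len: "length p = Suc L"
begin

interpretation tree_graph G by (rule tree)

text \<open>For \<open>L = 3\<close> the bounds on the projection leave only \<open>k = 1\<close>
  and \<open>j\<close> equal to 1 or 2: the tree is a double star whose two hubs are the center
  vertices.\<close>

lemma off_path_leaf_diameter_3:
  assumes L: "L = 3" and x: "x \<in> verts G" "x \<notin> set p"
  shows "leaf G x" and "\<exists>c \<in> set p. x \<rightarrow>\<^bsub>G\<^esub> c \<and> ecc G c = 2"
proof -
  note vp = longest_vpath[OF tree longest len]
  have pV: "p ! i \<in> verts G" "p ! i \<in> set p" if "i \<le> 3" for i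
    using nth_vpath_in_verts[OF vp] len L that by auto
  have att: "\<exists>j \<in> {1, 2}. y \<rightarrow>\<^bsub>G\<^esub> p ! j" if y: "y \<in> verts G" "y \<notin> set p" for y
  proof -
    obtain k j where k: "1 \<le> k" "k \<le> j" "j + k \<le> L"
      "\<And>i. i \<le> L \<Longrightarrow> graph_dist G y (p ! i) = k + ((i - j) + (j - i))"
      using projection_onto_longest_path[OF tree longest len y] by metis
    then have "k = 1" "j \<in> {1, 2}" using L by auto
    moreover have "graph_dist G y (p ! j) = k" using k L by simp
    ultimately have "y \<rightarrow>\<^bsub>G\<^esub> p ! j" using dist_eq_1D[OF y(1) pV(1)] by auto
    with \<open>j \<in> {1, 2}\<close> show ?thesis by blast
  qed
  have nbr: "w \<in> set p" if w: "x \<rightarrow>\<^bsub>G\<^esub> w" for w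
  proof (rule ccontr)
    assume w': "w \<notin> set p"
    have wV: "w \<in> verts G" "w \<noteq> x" using w adj_in_verts adj_not_same by auto
    obtain i j where i: "i \<in> {1, 2}" "x \<rightarrow>\<^bsub>G\<^esub> p ! i" and j: "j \<in> {1, 2}" "w \<rightarrow>\<^bsub>G\<^esub> p ! j"
      using att[OF x] att[OF wV(1) w'] by blast
    have le: "i \<le> 3" "j \<le> 3" using i j by auto
    have ne: "p ! i \<noteq> x" "p ! i \<noteq> w" "p ! j \<noteq> x" "p ! j \<noteq> w"
      using pV(2)[OF le(1)] pV(2)[OF le(2)] x(2) w' by auto
    \<comment> \<open>Adjacent off-path vertices \<open>x\<close> and \<open>w\<close> would close a
      triangle if attached to the same hub, and a 4-cycle through the edge between the hubs
      otherwise.\<close>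
    have path: "vpath [p ! i, x, w] G"
      using adj_sym[OF i(2)] w wV ne by (auto simp: vpath_def)
    show False
    proof (cases "i = j")
      case True
      then show False using no_closing_arc[OF path] j(2) by simp
    next
      case False
      then have d: "graph_dist G (p ! j) (p ! i) = 1"
        using dist_on_vpath[OF vp, of j i] i(1) j(1) len L by auto
      then have closing: "p ! j \<rightarrow>\<^bsub>G\<^esub> p ! i" using dist_eq_1D[OF pV(1)[OF le(2)] pV(1)[OF le(1)]] by simp
      have pij: "p ! j \<noteq> p ! i" using closing adj_not_same by metis
      have "vpath [p ! i, x, w, p ! j] G"
        using path j(2) pV(1)[OF le(2)] ne pij by (auto simp: vpath_def)
      then show False using no_closing_arc[of "[p ! i, x, w, p ! j]"] closing by simp
    qed
  qed
  obtain j where j: "j \<in> {1, 2}" "x \<rightarrow>\<^bsub>G\<^esub> p ! j" using att[OF x] by blast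
  show "leaf G x"
    using off_path_neighbour_unique[OF vp x(2)] nbr x(1) j(2)
    unfolding leaf_iff_unique_neighbour by blast
  have "ecc G (p ! j) = 2"
    using ecc_on_longest_path[OF tree longest len, of j] j(1) L by auto
  then show "\<exists>c \<in> set p. x \<rightarrow>\<^bsub>G\<^esub> c \<and> ecc G c = 2" using nbr j(2) by blast
qed

lemma card_verts_ge: "L + 1 \<le> card (verts G)"
  using longest_vpath[OF tree longest len] len card_mono[of "verts G" "set p"]
  by (auto simp: vpath_def vwalk_def distinct_card)

lemma ecc_leaf_on_longest_path:
  assumes "leaf G u" "u \<in> set p" shows "ecc G u = L"
proof -
  obtain i where "i \<le> L" "u = p ! i" using assms(2) len by (metis in_set_conv_nth less_Suc_eq_le)
  then show ?thesis
    using leaf_on_longest_path[OF tree longest len, of i] assms(1)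
      ecc_on_longest_path[OF tree longest len, of i] by auto
qed

lemma longest_path_spanning:
  assumes "card (verts G) = L + 1" shows "set p = verts G"
  using longest_vpath[OF tree longest len] len assms
  by (intro card_subset_eq) (auto simp: vpath_def vwalk_def distinct_card)

text \<open>If \<open>u\<close> is off \<open>p\<close>, it is the vertex sought. If it is an end of
  \<open>p\<close>, then \<open>L = 3\<close> and some vertex off \<open>p\<close> replaces it; this
  occurs only for orders 5 and 6, whence the stronger second conclusion from order 7 on.\<close>

lemma extremal_of_leaf_ecc:
  assumes u: "leaf G u" "ecc G u = Suc ((card (verts G) - 1) div 2)"
    and n: "5 \<le> card (verts G)" and r: "(L + 1) div 2 = (card (verts G) - 1) div 2"
  shows "\<exists>x c. extremal1 G x c \<or> extremal2 G x c"
    and "7 \<le> card (verts G) \<Longrightarrow> \<exists>c. extremal1 G u c \<or> extremal2 G u c"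
proof -
  let ?n = "card (verts G)"
  have "?n \<noteq> L + 1"
  proof
    assume "?n = L + 1"
    moreover from this have "ecc G u = L"
      using ecc_leaf_on_longest_path[OF u(1)] longest_path_spanning u(1) by (simp add: leaf_def)
    ultimately show False using u(2) n r by presburger
  qed
  \<comment> \<open>Equal halves of \<open>L + 1\<close> and \<open>?n - 1\<close> allow these two
    numbers to differ by at most one, and by one only if \<open>L + 1\<close> is even.\<close>
  then have cases: "?n = L + 2 \<or> ?n = L + 3 \<and> even ?n"
    using card_verts_ge r by presburger
  have off: "\<exists>c. extremal1 G u c \<or> extremal2 G u c" if u': "u \<notin> set p"
  proof -
    obtain c where c: "u \<rightarrow>\<^bsub>G\<^esub> c" using u(1) unfolding leaf_iff_unique_neighbour by blast
    then have cV: "c \<in> verts G" using adj_in_verts by blast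
    have ecc: "ecc G c = (L + 1) div 2" using ecc_leaf[OF u(1) c] n u(2) r by simp
    then have "\<not> L + 2 \<le> 2 * ecc G c" by simp
    then have "c \<in> set p" using ecc_off_longest_path[OF tree longest len cV] by blast
    then show ?thesis using leaf_extremal[OF tree longest len u(1) u' c _ ecc cases] by blast
  qed
  \<comment> \<open>A leaf on \<open>p\<close> has eccentricity \<open>L\<close>, so
    \<open>L\<close> is one more than its own rounded-up half; with at least five vertices only 3
    remains.\<close>
  have on: "L = 3" if "u \<in> set p"
    using ecc_leaf_on_longest_path[OF u(1) that] u(2) r n by presburger
  show "7 \<le> ?n \<Longrightarrow> \<exists>c. extremal1 G u c \<or> extremal2 G u c"
    using off on cases by (cases "u \<in> set p") simp_all
  show "\<exists>x c. extremal1 G x c \<or> extremal2 G x c"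
  proof (cases "u \<in> set p")
    case True
    note L = on[OF True]
    have "\<not> verts G \<subseteq> set p"
      using card_mono[of "set p" "verts G"] card_length[of p] len cases by auto
    then obtain x where x: "x \<in> verts G" "x \<notin> set p" by blast
    obtain c where c: "c \<in> set p" "x \<rightarrow>\<^bsub>G\<^esub> c" "ecc G c = 2"
      using off_path_leaf_diameter_3(2)[OF L x] by blast
    have "ecc G c = (L + 1) div 2" using c(3) L by simp
    then show ?thesis
      using leaf_extremal[OF tree longest len off_path_leaf_diameter_3(1)[OF L x] x(2) c(2,1) _ cases]
      by blast
  qed (use off in blast)
qed

end

section \<open>Transfer from \<open>simple_tree\<close> and the final inequalities\<close>

lemma simple_tree_imp_tree_graph:
  assumes "simple_tree G" shows "tree_graph G"
proof -
  interpret graph G using assms by (simp add: simple_tree_def)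
  have "strongly_connected G"
    using assms symmetric_connected_imp_strongly_connected[OF sym_arcs] by (simp add: simple_tree_def)
  show ?thesis
  proof
    show "x \<rightarrow>\<^sup>*\<^bsub>G\<^esub> y" if "x \<in> verts G" "y \<in> verts G" for x y
      using \<open>strongly_connected G\<close> that by blast
    show "\<not> last p \<rightarrow>\<^bsub>G\<^esub> hd p" if p: "vpath p G" "3 \<le> length p" for p
    proof
      assume "last p \<rightarrow>\<^bsub>G\<^esub> hd p"
      then obtain e where e: "e \<in> arcs G" "tail G e = last p" "head G e = hd p" by auto
      obtain q where q: "awalk (hd p) q (last p)" "awalk_verts (hd p) q = p"
        using vwalk_imp_awalk p(1) by blast
      have "length p = Suc (length q)" using q(2) length_awalk_verts[of "hd p" q] by simp
      moreover have "cycle (e # q)"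
        unfolding cycle_def using q e p(1)
        by (intro exI[of _ "last p"]) (auto simp: awalk_simps vpath_def)
      ultimately show False using assms p(2) unfolding simple_tree_def by force
    qed
  qed
qed

text \<open>Clears denominators, so that the rest is arithmetic on natural numbers with
  \<open>r\<close> the radius and \<open>e\<close> the eccentricity of a leaf.\<close>

lemma ratio_eq_iff:
  fixes m r e :: nat
  assumes "0 < m" "0 < r"
  shows "1 + 1 / real m = real e / real r \<longleftrightarrow> r * (m + 1) = m * e"
    and "1 + 1 / real m \<le> real e / real r \<longleftrightarrow> r * (m + 1) \<le> m * e"
proof -
  have "1 + 1 / real m = real (m + 1) / real m" using assms by (simp add: field_simps)
  then have "1 + 1 / real m = real e / real r \<longleftrightarrow> real (r * (m + 1)) = real (m * e)"
    "1 + 1 / real m \<le> real e / real r \<longleftrightarrow> real (r * (m + 1)) \<le> real (m * e)"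
    using assms by (simp_all add: frac_eq_eq frac_le_eq field_simps)
  then show "1 + 1 / real m = real e / real r \<longleftrightarrow> r * (m + 1) = m * e"
    "1 + 1 / real m \<le> real e / real r \<longleftrightarrow> r * (m + 1) \<le> m * e"
    by (simp_all only: of_nat_eq_iff of_nat_le_iff)
qed

text \<open>The equivalence speaks of some leaf of the tree, because for \<open>n\<close> equal to 5
  or 6 a given leaf can attain equality as an end of every longest path: attach a fifth vertex to
  the second vertex of a path on four vertices and take the fourth. From \<open>n = 7\<close> on it
  holds for the given leaf \<open>u\<close>. Its neighbour \<open>c\<close> is quantified
  separately, since the center may have two vertices.\<close>

theorem theorem2p5:
  fixes T :: "('a, 'b) pre_digraph" and n :: nat and u v :: 'a
  assumes "simple_tree T" and "card (verts T) = n" and "n \<ge> 3"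
    and "leaf T u" and "v \<in> center T"
  shows "real (ecc T u) / real (ecc T v) \<le> 2 \<and>
    (n \<ge> 5 \<longrightarrow>
      1 + 1 / real ((n - 1) div 2) \<le> real (ecc T u) / real (ecc T v) \<and>
      ((\<exists>x y. leaf T x \<and> y \<in> center T \<and>
          1 + 1 / real ((n - 1) div 2) = real (ecc T x) / real (ecc T y))
        \<longleftrightarrow> (\<exists>x y. extremal1 T x y \<or> extremal2 T x y)) \<and>
      ((\<exists>c. extremal1 T u c \<or> extremal2 T u c)
        \<longrightarrow> 1 + 1 / real ((n - 1) div 2) = real (ecc T u) / real (ecc T v)) \<and>
      (n \<ge> 7 \<longrightarrow> 1 + 1 / real ((n - 1) div 2) = real (ecc T u) / real (ecc T v)
        \<longrightarrow> (\<exists>c. extremal1 T u c \<or> extremal2 T u c)))"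
proof -
  have tree: "tree_graph T" using simple_tree_imp_tree_graph[OF assms(1)] .
  then interpret tree_graph T .
  have n: "card (verts T) = n" "3 \<le> n" using assms by auto
  have "verts T \<noteq> {}" using n by auto
  then obtain p where longest: "longest_path T p" using longest_path_ex by blast
  then obtain L where len: "length p = Suc L"
    by (cases p) (auto simp: longest_path_def vpath_def)
  define m where "m = (n - 1) div 2"
  define r where "r = (L + 1) div 2"
  have center: "ecc T y = r" if "y \<in> center T" for y
    using that center_iff_ecc[OF tree longest len] by (simp add: r_def)
  have gt: "r < ecc T x" if x: "leaf T x" for x
  proof -
    obtain y where y: "x \<rightarrow>\<^bsub>T\<^esub> y" using x unfolding leaf_iff_unique_neighbour by blast
    then have "ecc T x = Suc (ecc T y)" using ecc_leaf[OF x y] n by simp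
    then show ?thesis
      using ecc_ge_half_longest[OF tree longest len, of y] adj_in_verts[OF y] by (simp add: r_def)
  qed
  have uv: "u \<in> verts T" "v \<in> verts T" using assms by (auto simp: leaf_def center_def)
  have "real (ecc T u) \<le> 2 * real (ecc T v)"
    using ecc_le_double[OF uv] by linarith
  then have le_2: "real (ecc T u) / real (ecc T v) \<le> 2"
    by (cases "ecc T v = 0") (auto simp: divide_le_eq)
  have Ln: "L + 1 \<le> n" using card_verts_ge[OF tree longest len] n by simp
  have "0 < r"
  proof (rule ccontr)
    assume "\<not> 0 < r"
    then have "ecc T v = 0" using center assms(5) by simp
    then show False using gt[OF assms(4)] ecc_le_double[OF uv] by simp
  qed
  have bound: "r * (m + 1) \<le> m * ecc T u" if n5: "5 \<le> n"
  proof (cases "r \<le> m")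
    case True
    have "r * (m + 1) \<le> m * (r + 1)" using True by (simp add: algebra_simps)
    also have "\<dots> \<le> m * ecc T u" using gt[OF assms(4)] by (intro mult_le_mono) simp_all
    finally show ?thesis .
  next
    case False
    \<comment> \<open>A radius above \<open>m\<close> leaves only a path with \<open>n\<close> even.
      There the claim amounts to \<open>m + 1 \<le> m * m\<close>, which is where
      \<open>5 \<le> n\<close> enters.\<close>
    have "n = L + 1" using False Ln unfolding r_def m_def by presburger
    then have "ecc T u = L"
      using ecc_leaf_on_longest_path[OF tree longest len assms(4)]
        longest_path_spanning[OF tree longest len] uv n by simp
    then have "r = m + 1" "ecc T u = 2 * m + 1"
      using False \<open>n = L + 1\<close> unfolding r_def m_def by presburger+
    moreover have "2 \<le> m" using n5 by (simp add: m_def)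
    then have "m + 1 \<le> m * m" using mult_le_mono1[of 2 m m] by linarith
    ultimately show ?thesis by (simp add: algebra_simps)
  qed
  have eq_iff: "r * (m + 1) = m * ecc T x \<longleftrightarrow> r = m \<and> ecc T x = Suc m"
    if n5: "5 \<le> n" and x: "leaf T x" for x
  proof
    assume eq: "r * (m + 1) = m * ecc T x"
    \<comment> \<open>Substituting \<open>r + k\<close> turns the equation into
      \<open>r = m * k\<close>. Since \<open>r \<le> m + 1 < 2 * m\<close>, only
      \<open>k = 1\<close> is possible.\<close>
    obtain k where k: "ecc T x = r + k" "1 \<le> k"
      using gt[OF x] by (metis add_Suc_right le_add1 less_iff_Suc_add plus_1_eq_Suc)
    have rk: "r = m * k" using eq k(1) by (simp add: algebra_simps)
    have "r \<le> m + 1" "2 \<le> m" using Ln n5 unfolding r_def m_def by linarith+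
    have "k < 2"
    proof (rule ccontr)
      assume "\<not> k < 2"
      then have "m * 2 \<le> r" unfolding rk by (intro mult_le_mono) auto
      with \<open>r \<le> m + 1\<close> \<open>2 \<le> m\<close> show False by linarith
    qed
    then have "k = 1" using k(2) by simp
    with rk k show "r = m \<and> ecc T x = Suc m" by simp
  qed simp
  have eq: "1 + 1 / real m = real (ecc T x) / real (ecc T y) \<longleftrightarrow> r = m \<and> ecc T x = Suc m"
    if "5 \<le> n" "leaf T x" "y \<in> center T" for x y
    using ratio_eq_iff(1)[of m r "ecc T x"] eq_iff[OF that(1,2)] center[OF that(3)] \<open>0 < r\<close> that(1)
    by (simp add: m_def)
  have extremal: "leaf T x \<and> r = m \<and> ecc T x = Suc m" if "extremal1 T x c \<or> extremal2 T x c" for x c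
    using extremal_leaf[OF that] center[OF assms(5)] assms(5) n by (simp add: m_def)
  show ?thesis
  proof (intro conjI impI)
    show "real (ecc T u) / real (ecc T v) \<le> 2" by (rule le_2)
  next
    assume n5: "5 \<le> n"
    show "1 + 1 / real ((n - 1) div 2) \<le> real (ecc T u) / real (ecc T v)"
      using ratio_eq_iff(2)[of m r "ecc T u"] bound[OF n5] center[OF assms(5)] \<open>0 < r\<close> n5
      by (simp add: m_def)
    show "(\<exists>x y. leaf T x \<and> y \<in> center T \<and>
          1 + 1 / real ((n - 1) div 2) = real (ecc T x) / real (ecc T y))
        \<longleftrightarrow> (\<exists>x y. extremal1 T x y \<or> extremal2 T x y)" (is "?L \<longleftrightarrow> ?R")
    proof
      assume ?L
      then obtain x where x: "leaf T x" "r = m" "ecc T x = Suc m"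
        using eq[OF n5] unfolding m_def by blast
      then show ?R
        using extremal_of_leaf_ecc(1)[OF tree longest len x(1)] n n5 by (simp add: m_def r_def)
    next
      assume ?R
      then obtain x where "leaf T x" "r = m" "ecc T x = Suc m" using extremal by blast
      then show ?L using eq[OF n5 _ assms(5)] assms(5) unfolding m_def by blast
    qed
    show "1 + 1 / real ((n - 1) div 2) = real (ecc T u) / real (ecc T v)"
      if "\<exists>c. extremal1 T u c \<or> extremal2 T u c"
      using extremal that eq[OF n5 assms(4,5)] unfolding m_def by blast
    show "\<exists>c. extremal1 T u c \<or> extremal2 T u c"
      if "7 \<le> n" "1 + 1 / real ((n - 1) div 2) = real (ecc T u) / real (ecc T v)"
      using extremal_of_leaf_ecc(2)[OF tree longest len assms(4)] that eq[OF n5 assms(4,5)] n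
      by (simp add: m_def r_def)
  qed
qed

end
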